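(* Let $N\ge2$ and, for $0\le\lambda\le\left(\frac{N-1}{2}\right)^2$, let $h_N(\lambda):=\frac{\sqrt{(N-1)^2-4\lambda}+1}{2}$. For all $0\le\lambda\le\left(\frac{N-1}{2}\right)^2$ and all $u\in C_c^\infty(\mathbb{H}^N\setminus\{x_0\})$ (not necessarily radial), $$\left(\int_{\mathbb{H}^N}\left(|\Delta_{r,\mathbb{H}^N}u|^2-\lambda|\nabla_{r,\mathbb{H}^N}u|^2\right)dv_{\mathbb{H}^N}\right)\left(\int_{\mathbb{H}^N}r^2|\nabla_{r,\mathbb{H}^N}u|^2\,dv_{\mathbb{H}^N}\right)\ge h_N^2(\lambda)\left(\int_{\mathbb{H}^N}|\nabla_{r,\mathbb{H}^N}u|^2\,dv_{\mathbb{H}^N}\right)^2.$$ In particular, for $\lambda=0$, $$\left(\int_{\mathbb{H}^N}|\Delta_{r,\mathbb{H}^N}u|^2\,dv_{\mathbb{H}^N}\right)\left(\int_{\mathbb{H}^N}r^2|\nabla_{r,\mathbb{H}^N}u|^2\,dv_{\mathbb{H}^N}\right)\ge\frac{N^2}{4}\left(\int_{\mathbb{H}^N}|\nabla_{r,\mathbb{H}^N}u|^2\,dv_{\mathbb{H}^N}\right)^2$$ for all $u\in C_c^\infty(\mathbb{H}^N\setminus\{x_0\})$.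
   Context: $\mathbb{H}^N$ is the $N$-dimensional hyperbolic space (constant curvature $-1$) with Riemannian volume $dv_{\mathbb{H}^N}$; $x_0\in\mathbb{H}^N$ is a fixed pole and $r=d(x,x_0)$ is the geodesic distance. In polar coordinates $(r,\Theta)\in(0,\infty)\times\mathbb{S}^{N-1}$ about $x_0$, $dv_{\mathbb{H}^N}=(\sinh r)^{N-1}\,dr\,d\Theta$. Functions are real-valued. With $u_r=\frac{\partial u}{\partial r}$, the radial gradient is $\nabla_{r,\mathbb{H}^N}u=(u_r,0)$, so $|\nabla_{r,\mathbb{H}^N}u|^2=u_r^2$, and the radial Laplacian is $\Delta_{r,\mathbb{H}^N}u=u_{rr}+(N-1)\coth r\,u_r$. *)

theory Defs
  imports "HOL-Analysis.Analysis"
begin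

(* Hyperbolic space of dimension CARD('n) is the upper sheet of the unit hyperboloid in
   Minkowski space; the last component of the pair is the time coordinate. *)

definition minkowski :: "(real^'n) \<times> real \<Rightarrow> (real^'n) \<times> real \<Rightarrow> real" where
  "minkowski x y = fst x \<bullet> fst y - snd x * snd y"

definition hyperbolic_space :: "((real^'n) \<times> real) set" where
  "hyperbolic_space = {x. minkowski x x = - 1 \<and> snd x > 0}"

definition hyp_dist :: "(real^'n) \<times> real \<Rightarrow> (real^'n) \<times> real \<Rightarrow> real" where
  "hyp_dist x y = arcosh (- minkowski x y)"

definition hyp_chart :: "real^'n \<Rightarrow> (real^'n) \<times> real" where
  "hyp_chart y = (y, sqrt (1 + y \<bullet> y))"

definition hyp_metric :: "real^'n \<Rightarrow> real^'n^'n" where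
  "hyp_metric y = (\<chi> i j. minkowski (frechet_derivative hyp_chart (at y) (axis i 1))
                                   (frechet_derivative hyp_chart (at y) (axis j 1)))"

(* The Riemannian volume of the metric that the Minkowski form induces on the hyperboloid, a
   measure whose space is the hyperboloid itself: integrals ignore values off the hyperboloid. *)
definition hyp_volume :: "((real^'n) \<times> real) measure" where
  "hyp_volume = distr (density lborel (\<lambda>y. ennreal (sqrt (det (hyp_metric y)))))
                      (restrict_space borel hyperbolic_space) hyp_chart"

(* Geodesic polar coordinates about x0: for a unit tangent vector v at x0, the curve
   r \<mapsto> hyp_polar x0 r v is the unit-speed geodesic issuing from x0 in direction v. *)

definition hyp_polar :: "(real^'n) \<times> real \<Rightarrow> real \<Rightarrow> (real^'n) \<times> real \<Rightarrow> (real^'n) \<times> real" where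
  "hyp_polar x0 r v = cosh r *\<^sub>R x0 + sinh r *\<^sub>R v"

definition hyp_direction :: "(real^'n) \<times> real \<Rightarrow> (real^'n) \<times> real \<Rightarrow> (real^'n) \<times> real" where
  "hyp_direction x0 x =
     (1 / sinh (hyp_dist x0 x)) *\<^sub>R (x - cosh (hyp_dist x0 x) *\<^sub>R x0)"

definition radial_deriv ::
  "(real^'n) \<times> real \<Rightarrow> ((real^'n) \<times> real \<Rightarrow> real) \<Rightarrow> (real^'n) \<times> real \<Rightarrow> real" where
  "radial_deriv x0 u x = deriv (\<lambda>r. u (hyp_polar x0 r (hyp_direction x0 x))) (hyp_dist x0 x)"

(* The radial gradient (u_r, 0) as a tangent vector: u_r times the coordinate field of r. *)
definition radial_gradient ::
  "(real^'n) \<times> real \<Rightarrow> ((real^'n) \<times> real \<Rightarrow> real) \<Rightarrow> (real^'n) \<times> real \<Rightarrow> (real^'n) \<times> real" where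
  "radial_gradient x0 u x = radial_deriv x0 u x *\<^sub>R
     vector_derivative (\<lambda>r. hyp_polar x0 r (hyp_direction x0 x)) (at (hyp_dist x0 x))"

definition radial_laplacian ::
  "(real^'n) \<times> real \<Rightarrow> ((real^'n) \<times> real \<Rightarrow> real) \<Rightarrow> (real^'n) \<times> real \<Rightarrow> real" where
  "radial_laplacian x0 u x =
     radial_deriv x0 (radial_deriv x0 u) x
     + (real CARD('n) - 1) * (cosh (hyp_dist x0 x) / sinh (hyp_dist x0 x)) * radial_deriv x0 u x"

(* Only for open S. *)
primrec Ck_on :: "nat \<Rightarrow> (real^'n) set \<Rightarrow> (real^'n \<Rightarrow> real) \<Rightarrow> bool" where
  "Ck_on 0 S f \<longleftrightarrow> continuous_on S f"
| "Ck_on (Suc k) S f \<longleftrightarrow> (\<forall>y\<in>S. f differentiable (at y)) \<and>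
     (\<forall>i. Ck_on k S (\<lambda>y. frechet_derivative f (at y) (axis i 1)))"

(* Smooth functions on the hyperboloid without x0 that vanish off a compact subset of it. The
   value at x0, and values off the hyperboloid, are irrelevant. *)
definition test_functions :: "(real^'n) \<times> real \<Rightarrow> ((real^'n) \<times> real \<Rightarrow> real) set" where
  "test_functions x0 =
     {u. (\<forall>k. Ck_on k (hyp_chart -` (hyperbolic_space - {x0})) (u \<circ> hyp_chart)) \<and>
         (\<exists>K. compact K \<and> K \<subseteq> hyperbolic_space - {x0} \<and>
              (\<forall>x \<in> hyperbolic_space - {x0} - K. u x = 0))}"

definition h_const :: "nat \<Rightarrow> real \<Rightarrow> real" where
  "h_const N lam = (sqrt ((real N - 1)\<^sup>2 - 4 * lam) + 1) / 2"

lemma hyp_chart_in: "hyp_chart y \<in> hyperbolic_space"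
proof -
  have "1 + y \<bullet> y > 0" by (simp add: add_pos_nonneg)
  then show ?thesis
    by (simp add: hyp_chart_def hyperbolic_space_def minkowski_def)
qed

lemma hyp_chart_fst:
  assumes "x \<in> hyperbolic_space"
  shows "hyp_chart (fst x) = x"
proof -
  have "1 + fst x \<bullet> fst x = (snd x)\<^sup>2" "snd x > 0"
    using assms by (auto simp: hyperbolic_space_def minkowski_def power2_eq_square)
  then show ?thesis by (simp add: hyp_chart_def prod_eq_iff)
qed

lemma minkowski_le:
  assumes "x \<in> hyperbolic_space" "y \<in> hyperbolic_space"
  shows "- minkowski x y \<ge> 1" and "- minkowski x y = 1 \<longleftrightarrow> x = y"
proof -
  obtain a s b t where xy: "x = (a, s)" "y = (b, t)" by fastforce
  have s: "s\<^sup>2 = 1 + (norm a)\<^sup>2" "s > 0" and t: "t\<^sup>2 = 1 + (norm b)\<^sup>2" "t > 0"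
    using assms unfolding xy
    by (auto simp: hyperbolic_space_def minkowski_def power2_eq_square dot_square_norm)
  have ab: "(norm (a - b))\<^sup>2 = (norm a)\<^sup>2 + (norm b)\<^sup>2 - 2 * (a \<bullet> b)"
    by (simp add: power2_norm_eq_inner inner_diff_left inner_diff_right inner_commute)
  have cs: "a \<bullet> b \<le> norm a * norm b" by (rule norm_cauchy_schwarz)
  have "(1 + norm a * norm b)\<^sup>2 + (norm a - norm b)\<^sup>2 = (s * t)\<^sup>2"
    unfolding power_mult_distrib s t by (simp add: power2_eq_square algebra_simps)
  then have "(1 + norm a * norm b)\<^sup>2 \<le> (s * t)\<^sup>2"
    by (metis le_add_same_cancel1 zero_le_power2)
  then have st: "1 + norm a * norm b \<le> s * t"
    using s(2) t(2) power2_le_imp_le by fastforce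
  have m: "- minkowski x y = s * t - a \<bullet> b" by (simp add: xy minkowski_def)
  show "- minkowski x y \<ge> 1" unfolding m using st cs by linarith
  show "- minkowski x y = 1 \<longleftrightarrow> x = y"
  proof
    assume "- minkowski x y = 1"
    then have e: "s * t = 1 + norm a * norm b" "a \<bullet> b = norm a * norm b"
      using st cs m by linarith+
    have "(norm a - norm b)\<^sup>2 = 0"
      using \<open>(1 + norm a * norm b)\<^sup>2 + (norm a - norm b)\<^sup>2 = (s * t)\<^sup>2\<close> e by simp
    then have n: "norm a = norm b" by simp
    then have "(norm (a - b))\<^sup>2 = 0" using ab e(2) by (simp add: power2_eq_square)
    then have "a = b" by simp
    moreover have "s = t" using s t n by (metis less_eq_real_def power2_eq_imp_eq)
    ultimately show "x = y" by (simp add: xy)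
  next
    assume "x = y"
    then show "- minkowski x y = 1" using assms by (simp add: hyperbolic_space_def)
  qed
qed

lemma cosh_hyp_dist:
  assumes "x \<in> hyperbolic_space" "y \<in> hyperbolic_space"
  shows "cosh (hyp_dist x y) = - minkowski x y"
  using minkowski_le(1)[OF assms] by (simp add: hyp_dist_def cosh_arcosh_real)

lemma hyp_dist_pos:
  assumes "x \<in> hyperbolic_space" "y \<in> hyperbolic_space" "x \<noteq> y"
  shows "hyp_dist x y > 0"
proof -
  have "- minkowski x y > 1" using minkowski_le[OF assms(1,2)] assms(3) by linarith
  then show ?thesis unfolding hyp_dist_def by simp
qed

lemma minkowski_simps:
  "minkowski (x + y) z = minkowski x z + minkowski y z"
  "minkowski (x - y) z = minkowski x z - minkowski y z"
  "minkowski (c *\<^sub>R x) z = c * minkowski x z"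
  "minkowski z (x + y) = minkowski z x + minkowski z y"
  "minkowski z (x - y) = minkowski z x - minkowski z y"
  "minkowski z (c *\<^sub>R x) = c * minkowski z x"
  by (simp_all add: minkowski_def algebra_simps inner_add_left inner_add_right inner_diff_left
      inner_diff_right)

lemma minkowski_commute: "minkowski x y = minkowski y x"
  by (simp add: minkowski_def inner_commute mult.commute)

lemma hyp_polar_direction:
  assumes "x0 \<in> hyperbolic_space" "x \<in> hyperbolic_space" "x \<noteq> x0"
  shows "hyp_polar x0 (hyp_dist x0 x) (hyp_direction x0 x) = x"
    and "minkowski x0 (hyp_direction x0 x) = 0"
    and "minkowski (hyp_direction x0 x) (hyp_direction x0 x) = 1"
proof -
  define r where "r = hyp_dist x0 x"
  have "r > 0" using hyp_dist_pos[of x0 x] assms unfolding r_def by auto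
  then have sp: "sinh r > 0" by simp
  have c: "minkowski x0 x = - cosh r" "minkowski x x0 = - cosh r"
    using cosh_hyp_dist[OF assms(1,2)] by (simp_all add: r_def minkowski_commute)
  have u: "minkowski x0 x0 = -1" "minkowski x x = -1"
    using assms by (simp_all add: hyperbolic_space_def)
  show "hyp_polar x0 (hyp_dist x0 x) (hyp_direction x0 x) = x"
    using sp by (simp add: hyp_polar_def hyp_direction_def flip: r_def)
  show "minkowski x0 (hyp_direction x0 x) = 0"
    by (simp add: hyp_direction_def minkowski_simps c u flip: r_def)
  have "minkowski (hyp_direction x0 x) (hyp_direction x0 x) = ((cosh r)\<^sup>2 - 1) / (sinh r)\<^sup>2"
    by (simp add: hyp_direction_def minkowski_simps c u power2_eq_square diff_divide_distrib flip: r_def)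
  also have "\<dots> = 1" using sp by (simp add: cosh_square_eq)
  finally show "minkowski (hyp_direction x0 x) (hyp_direction x0 x) = 1" .
qed

lemma hyp_polar_in:
  assumes "x0 \<in> hyperbolic_space" "minkowski x0 v = 0" "minkowski v v = 1" "r > 0"
  shows "hyp_polar x0 r v \<in> hyperbolic_space" "hyp_dist x0 (hyp_polar x0 r v) = r"
    "hyp_direction x0 (hyp_polar x0 r v) = v"
proof -
  obtain a s b t where xv: "x0 = (a, s)" "v = (b, t)" by fastforce
  have u: "minkowski x0 x0 = -1" "minkowski v x0 = 0"
    using assms by (simp_all add: hyperbolic_space_def minkowski_commute)
  have "minkowski (hyp_polar x0 r v) (hyp_polar x0 r v) = (sinh r)\<^sup>2 - (cosh r)\<^sup>2"
    by (simp add: hyp_polar_def minkowski_simps u assms power2_eq_square)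
  then have m: "minkowski (hyp_polar x0 r v) (hyp_polar x0 r v) = -1"
    by (simp add: cosh_square_eq)
  have s: "s > 0" "s\<^sup>2 = 1 + (norm a)\<^sup>2" and ab: "a \<bullet> b = s * t" and t: "t\<^sup>2 = (norm b)\<^sup>2 - 1"
    using assms unfolding xv
    by (auto simp: hyperbolic_space_def minkowski_def power2_eq_square dot_square_norm)
  have "(s * t)\<^sup>2 \<le> (norm a)\<^sup>2 * (norm b)\<^sup>2"
    using Cauchy_Schwarz_ineq[of a b] by (simp add: ab power2_norm_eq_inner)
  also have "\<dots> = (s\<^sup>2 - 1) * (t\<^sup>2 + 1)" using s t by simp
  finally have "t\<^sup>2 \<le> s\<^sup>2" by (simp add: power_mult_distrib algebra_simps)
  then have ts: "\<bar>t\<bar> \<le> s" using s(1) abs_le_square_iff[of t s] by simp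
  have "sinh r * - t \<le> sinh r * s" using ts assms(4) by (intro mult_left_mono) auto
  also have "\<dots> < cosh r * s" using s(1) sinh_less_cosh_real by simp
  finally have "snd (hyp_polar x0 r v) > 0" by (simp add: hyp_polar_def xv)
  with m show h: "hyp_polar x0 r v \<in> hyperbolic_space" by (simp add: hyperbolic_space_def)
  have "minkowski x0 (hyp_polar x0 r v) = - cosh r"
    by (simp add: hyp_polar_def minkowski_simps u assms)
  then show d: "hyp_dist x0 (hyp_polar x0 r v) = r"
    using assms(4) by (simp add: hyp_dist_def arcosh_cosh_real)
  show "hyp_direction x0 (hyp_polar x0 r v) = v"
    using assms(4) unfolding hyp_direction_def d by (simp add: hyp_polar_def)
qed

lemma radial_gradient_sq:
  assumes "x0 \<in> hyperbolic_space" "x \<in> hyperbolic_space" "x \<noteq> x0"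
  shows "minkowski (radial_gradient x0 u x) (radial_gradient x0 u x) = (radial_deriv x0 u x)\<^sup>2"
proof -
  define r where "r = hyp_dist x0 x"
  define v where "v = hyp_direction x0 x"
  have v: "minkowski x0 v = 0" "minkowski v x0 = 0" "minkowski v v = 1"
    using hyp_polar_direction[OF assms] by (simp_all add: v_def minkowski_commute)
  have x0: "minkowski x0 x0 = -1" using assms by (simp add: hyperbolic_space_def)
  have "((\<lambda>r. hyp_polar x0 r v) has_vector_derivative sinh r *\<^sub>R x0 + cosh r *\<^sub>R v) (at r)"
    unfolding hyp_polar_def by (auto intro!: derivative_eq_intros)
  then have vd: "vector_derivative (\<lambda>r. hyp_polar x0 r v) (at r) = sinh r *\<^sub>R x0 + cosh r *\<^sub>R v"
    by (rule vector_derivative_at)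
  have "minkowski (sinh r *\<^sub>R x0 + cosh r *\<^sub>R v) (sinh r *\<^sub>R x0 + cosh r *\<^sub>R v)
      = (cosh r)\<^sup>2 - (sinh r)\<^sup>2"
    by (simp add: minkowski_simps v x0 power2_eq_square)
  then have "minkowski (sinh r *\<^sub>R x0 + cosh r *\<^sub>R v) (sinh r *\<^sub>R x0 + cosh r *\<^sub>R v) = 1"
    by (simp add: cosh_square_eq)
  moreover have "radial_gradient x0 u x = radial_deriv x0 u x *\<^sub>R (sinh r *\<^sub>R x0 + cosh r *\<^sub>R v)"
    by (simp add: radial_gradient_def vd flip: r_def v_def)
  ultimately show ?thesis
    by (simp only: minkowski_simps(3,6) power2_eq_square mult_1_right)
qed

lemma hyp_metric_eq: "hyp_metric y $ i $ j = (if i = j then 1 else 0) - y $ i * y $ j / (1 + y \<bullet> y)"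
proof -
  have p: "1 + y \<bullet> y > 0" by (simp add: add_pos_nonneg)
  have "(hyp_chart has_derivative (\<lambda>h. (h, (y \<bullet> h) / sqrt (1 + y \<bullet> y)))) (at y)"
    unfolding hyp_chart_def using p
    by (auto intro!: derivative_eq_intros simp: inner_commute field_simps)
  then have "frechet_derivative hyp_chart (at y) = (\<lambda>h. (h, (y \<bullet> h) / sqrt (1 + y \<bullet> y)))"
    by (rule frechet_derivative_at[symmetric])
  then show ?thesis
    using p by (simp add: hyp_metric_def minkowski_def inner_axis) (simp add: axis_def)
qed

lemma det_hyp_metric:
  fixes y :: "real^'n"
  shows "det (hyp_metric y) = 1 / (1 + y \<bullet> y)"
proof -
  define k :: 'n where "k = undefined"
  have n: "norm (norm y *\<^sub>R axis k (1::real)) = norm y"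
    by (simp add: norm_axis_1)
  obtain f :: "real^'n \<Rightarrow> real^'n"
    where f: "orthogonal_transformation f" "f (norm y *\<^sub>R axis k 1) = y"
    by (rule orthogonal_transformation_exists[OF n])
  define Q where "Q = matrix f"
  have Q: "orthogonal_matrix Q" and lin: "linear f"
    using f(1) by (auto simp: Q_def orthogonal_transformation_matrix)
  have Qy: "y $ i = norm y * Q $ i $ k" for i
  proof -
    have "y = norm y *\<^sub>R f (axis k 1)" using f(2) lin by (simp add: linear_scale)
    then have "y $ i = norm y * f (axis k 1) $ i" by (metis real_scaleR_def vector_scaleR_component)
    then show ?thesis by (simp add: Q_def matrix_def)
  qed
  define D :: "real^'n^'n" where
    "D = (\<chi> i j. if i = j then (if i = k then 1 / (1 + y \<bullet> y) else 1) else 0)"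
  have p: "1 + y \<bullet> y > 0" by (simp add: add_pos_nonneg)
  then have q: "1 / (1 + y \<bullet> y) = 1 - (y \<bullet> y) / (1 + y \<bullet> y)"
    by (simp add: field_simps)
  have QQ: "(\<Sum>l\<in>UNIV. Q $ i $ l * Q $ j $ l) = (if i = j then 1 else 0)" for i j
  proof -
    have "(Q ** transpose Q) $ i $ j = (mat 1 :: real^'n^'n) $ i $ j"
      using Q by (simp add: orthogonal_matrix_def)
    then show ?thesis by (simp add: matrix_matrix_mult_def transpose_def mat_def)
  qed
  have "hyp_metric y $ i $ j = (Q ** D ** transpose Q) $ i $ j" for i j
  proof -
    have "(Q ** D) $ i $ l = Q $ i $ l * (if l = k then 1 / (1 + y \<bullet> y) else 1)" for l
      by (simp add: matrix_matrix_mult_def D_def if_distrib[of "(*) _"] cong: if_cong)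
    then have "(Q ** D ** transpose Q) $ i $ j
        = (\<Sum>l\<in>UNIV. Q $ i $ l * (if l = k then 1 / (1 + y \<bullet> y) else 1) * Q $ j $ l)"
      by (simp add: matrix_matrix_mult_def[of "Q ** D"] transpose_def)
    also have "\<dots> = (\<Sum>l\<in>UNIV. Q $ i $ l * Q $ j $ l
        - (if l = k then (y \<bullet> y) / (1 + y \<bullet> y) * Q $ i $ k * Q $ j $ k else 0))"
      by (intro sum.cong refl) (simp add: q left_diff_distrib right_diff_distrib)
    also have "\<dots> = (if i = j then 1 else 0) - (y \<bullet> y) / (1 + y \<bullet> y) * Q $ i $ k * Q $ j $ k"
      by (simp add: sum_subtractf QQ)
    also have "(y \<bullet> y) / (1 + y \<bullet> y) * Q $ i $ k * Q $ j $ k = y $ i * y $ j / (1 + y \<bullet> y)"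
      by (simp add: Qy[of i] Qy[of j] dot_square_norm power2_eq_square)
    finally show ?thesis by (simp add: hyp_metric_eq)
  qed
  then have "hyp_metric y = Q ** D ** transpose Q" by (simp add: vec_eq_iff)
  then have "det (hyp_metric y) = det Q * det D * det Q" by (simp add: det_mul)
  also have "\<dots> = det D" using det_orthogonal_matrix[OF Q] by auto
  also have "\<dots> = (\<Prod>i\<in>UNIV. D $ i $ i)" by (rule det_diagonal) (simp add: D_def)
  also have "\<dots> = 1 / (1 + y \<bullet> y)" by (simp add: D_def)
  finally show ?thesis .
qed

end

theory Submission
  imports Defs
begin

text \<open>
  Put \<open>n = N - 1\<close>, \<open>s = sqrt (n\<^sup>2 - 4 \<lambda>)\<close>, \<open>b = (n - s) / 2\<close> and \<open>f = u\<^sub>r\<close>, so that \<open>b (n - b) = \<lambda>\<close>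
  and \<open>h\<^sub>N(\<lambda>) = (s + 1) / 2\<close>. Since the coordinate field of \<open>r\<close> has divergence \<open>n coth r\<close>,
  \<open>g\<^sub>r + n coth r g\<close> integrates to \<open>0\<close> for every test function \<open>g\<close>. For \<open>g = coth r f\<^sup>2\<close> this gives
  \<open>\<integral> (f\<^sub>r + n coth r f)\<^sup>2 - \<lambda> f\<^sup>2 = \<integral> (f\<^sub>r + b coth r f)\<^sup>2 + (n - b) (1 + b) (coth\<^sup>2 r - 1) f\<^sup>2\<close>,
  and for \<open>g = r f\<^sup>2\<close> it gives
  \<open>- 2 \<integral> r f (f\<^sub>r + b coth r f) = \<integral> (1 + s r coth r) f\<^sup>2 \<ge> (1 + s) \<integral> f\<^sup>2\<close>.
  The Cauchy-Schwarz inequality for \<open>r f\<close> and \<open>f\<^sub>r + b coth r f\<close> concludes. Polar coordinates are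
  not needed: the divergence of the radial field is computed in the chart, for an arbitrary pole.
\<close>

section \<open>Integrals of directional derivatives in Euclidean space\<close>

lemma set_integral_directional_derivative_eq_0:
  fixes f :: "'a::euclidean_space \<Rightarrow> real"
  assumes U: "open U" and K: "compact K" "K \<subseteq> U"
    and der: "\<And>y. y \<in> U \<Longrightarrow> (f has_derivative f' y) (at y)"
    and cont: "continuous_on U (\<lambda>y. f' y e)"
    and zero: "\<And>y. y \<notin> K \<Longrightarrow> f y = 0"
  shows "(LINT y:K|lborel. f' y e) = 0"
proof - \<comment> \<open>By translation invariance the difference quotients integrate to 0.\<close>
  \<comment> \<open>The derivative along \<open>e\<close> on the whole space: off \<open>K\<close>,
    where \<open>f\<close> vanishes on an open set, it is 0.\<close>
  define d where "d y = indicat_real K y *\<^sub>R f' y e" for y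
  have derK: "(f has_derivative (\<lambda>h. 0)) (at z)" if "z \<notin> K" for z
  proof (rule has_derivative_transform_within_open[where f = "\<lambda>_. 0" and s = "- K"])
    show "open (- K)" using K(1) by (simp add: compact_imp_closed open_Compl)
  qed (use that zero in auto)
  have curve: "((\<lambda>t. f (y + t *\<^sub>R e)) has_real_derivative d (y + t *\<^sub>R e)) (at t)" for y t
  proof -
    let ?z = "y + t *\<^sub>R e"
    obtain D where D: "(f has_derivative D) (at ?z)" "D e = d ?z"
    proof (cases "?z \<in> K")
      case True
      then show ?thesis using der[of ?z] K(2) that[of "f' ?z"] by (auto simp: d_def)
    next
      case False
      then show ?thesis using derK[of ?z] that[of "\<lambda>_. 0"] by (auto simp: d_def)
    qed
    have "((\<lambda>t. f (y + t *\<^sub>R e)) has_derivative (\<lambda>s. D (s *\<^sub>R e))) (at t)"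
      by (rule has_derivative_compose[of "\<lambda>t. y + t *\<^sub>R e" _ _ UNIV f])
        (auto intro!: derivative_eq_intros D(1))
    moreover have "D (s *\<^sub>R e) = d ?z * s" for s
      using D linear_scale[OF has_derivative_linear[OF D(1)]] by simp
    ultimately show ?thesis by (simp add: has_field_derivative_def)
  qed
  have "compact ((\<lambda>y. f' y e) ` K)"
    using cont K by (intro compact_continuous_image) (auto intro: continuous_on_subset)
  then obtain B where B: "\<bar>f' y e\<bar> \<le> B" if "y \<in> K" for y
    using compact_imp_bounded bounded_real by (metis imageI)
  define M where "M = max B 0"
  have M: "M \<ge> 0" "\<bar>d y\<bar> \<le> M" for y
    using B[of y] by (auto simp: M_def d_def indicator_def)
  obtain R where R: "K \<subseteq> cball 0 R"
    using compact_imp_bounded[OF K(1)] unfolding bounded_iff by fastforce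
  \<comment> \<open>Off \<open>L\<close> both \<open>y\<close> and
    \<open>y + \<epsilon> n *\<^sub>R e\<close> lie outside \<open>K\<close>, because the increment
    has length at most \<open>norm e\<close>. So all difference quotients vanish off the compact set
    \<open>L\<close>.\<close>
  define L where "L = cball (0::'a) (R + norm e)"
  define \<epsilon> where "\<epsilon> n = inverse (real (Suc n))" for n
  have \<epsilon>: "\<epsilon> n > 0" "\<epsilon> n \<le> 1" for n by (auto simp: \<epsilon>_def field_simps)
  define s where "s n y = (f (y + \<epsilon> n *\<^sub>R e) - f y) / \<epsilon> n" for n y
  have "isCont f y" for y
    using der[of y] derK[of y] K(2) has_derivative_continuous by (cases "y \<in> K") blast+
  then have contf: "continuous_on UNIV f"
    by (simp add: continuous_at_imp_continuous_on)
  then have [measurable]: "f \<in> borel_measurable borel"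
    by (rule borel_measurable_continuous_onI)
  have "f = (\<lambda>y. indicat_real K y *\<^sub>R f y)" using zero by (force simp: indicator_def)
  moreover have "integrable lborel (\<lambda>y. indicat_real K y *\<^sub>R f y)"
    using contf K(1) by (intro borel_integrable_compact) (auto intro: continuous_on_subset)
  ultimately have intf: "integrable lborel f" by simp
  have tr: "lborel = distr lborel borel (\<lambda>y. v + y)" for v :: 'a
    using lborel_distr_plus[of v] by (simp add: comp_def)
  have shift: "integrable lborel (\<lambda>y. f (y + v))" "(LINT y|lborel. f (y + v)) = (LINT y|lborel. f y)" for v
  proof -
    show "integrable lborel (\<lambda>y. f (y + v))"
      using intf by (subst (asm) tr[of v]) (simp add: integrable_distr_eq add.commute)
    show "(LINT y|lborel. f (y + v)) = (LINT y|lborel. f y)"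
      by (subst (2) tr[of v]) (simp add: integral_distr add.commute)
  qed
  have s0: "(LINT y|lborel. s n y) = 0" for n
    unfolding s_def using shift intf by simp
  have lim: "(\<lambda>n. s n y) \<longlonglongrightarrow> d y" for y
  proof -
    have "((\<lambda>h. (f (y + h *\<^sub>R e) - f y) / h) \<longlongrightarrow> d y) (at 0)"
      using curve[of y 0] by (simp add: DERIV_def)
    moreover have "filterlim \<epsilon> (at 0) sequentially"
      unfolding filterlim_at \<epsilon>_def using LIMSEQ_inverse_real_of_nat by auto
    ultimately show ?thesis unfolding s_def by (rule filterlim_compose)
  qed
  have bound: "\<bar>s n y\<bar> \<le> indicat_real L y *\<^sub>R M" for n y
  proof (cases "y \<in> L")
    case True
    \<comment> \<open>By the mean value theorem the quotient is a value of \<open>d\<close>, hence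
      bounded by \<open>M\<close> uniformly in \<open>n\<close>.\<close>
    have "\<exists>t>0. t < \<epsilon> n \<and> f (y + \<epsilon> n *\<^sub>R e) - f (y + 0 *\<^sub>R e) = (\<epsilon> n - 0) * d (y + t *\<^sub>R e)"
      by (rule MVT2) (use \<epsilon> curve in auto)
    then obtain t where "f (y + \<epsilon> n *\<^sub>R e) - f y = \<epsilon> n * d (y + t *\<^sub>R e)" by auto
    then have "s n y = d (y + t *\<^sub>R e)" using \<epsilon>(1)[of n] by (simp add: s_def)
    then show ?thesis using True M by simp
  next
    case False
    then have n: "norm y > R + norm e" by (simp add: L_def)
    have "norm (\<epsilon> n *\<^sub>R e) \<le> norm e"
      using \<epsilon>[of n] by (simp add: mult_left_le_one_le)
    then have "norm (y + \<epsilon> n *\<^sub>R e) > R"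
      using n norm_triangle_ineq4[of "y + \<epsilon> n *\<^sub>R e" "\<epsilon> n *\<^sub>R e"] by simp
    moreover have "norm y > R" using n norm_ge_zero[of e] by linarith
    ultimately have "y \<notin> K" "y + \<epsilon> n *\<^sub>R e \<notin> K" using R by auto
    then show ?thesis using False by (simp add: s_def zero)
  qed
  have "(\<lambda>n. LINT y|lborel. s n y) \<longlonglongrightarrow> (LINT y|lborel. d y)"
  proof (rule integral_dominated_convergence)
    show sm: "s n \<in> borel_measurable lborel" for n unfolding s_def by (measurable)
    show "d \<in> borel_measurable lborel"
      using lim sm by (rule borel_measurable_LIMSEQ_metric[rotated])
    show "integrable lborel (\<lambda>y. indicat_real L y *\<^sub>R M)"
      by (intro borel_integrable_compact) (auto simp: L_def)
  qed (use lim bound in auto)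
  then have "(LINT y|lborel. d y) = 0" by (simp add: s0 LIMSEQ_const_iff)
  then show ?thesis by (simp add: d_def set_lebesgue_integral_def)
qed

section \<open>Radial geometry read in the chart\<close>

locale hyp_pole =
  fixes x0 :: "(real^'n) \<times> real"
  assumes pole: "x0 \<in> hyperbolic_space"
begin

text \<open>
  Everything is read in the chart \<open>hyp_chart\<close>. With \<open>r\<close> the distance to the pole, \<open>ch\<close>, \<open>sh\<close>,
  \<open>ct\<close> are \<open>cosh r\<close>, \<open>sinh r\<close>, \<open>coth r\<close>, \<open>rho\<close> is the density of the volume and \<open>V\<close> the
  coordinate field of \<open>r\<close>; \<open>ch' y\<close> and \<open>V' y\<close> are the derivatives of \<open>ch\<close> and \<open>V\<close> at \<open>y\<close>.
  At the pole itself \<open>sh\<close> is \<open>0\<close>, so there \<open>ct\<close> and \<open>V\<close> have the junk value \<open>0\<close>.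
\<close>

definition "rho y = 1 / sqrt (1 + y \<bullet> y)" for y :: "real^'n"
definition "ch y = - minkowski x0 (hyp_chart y)"
definition "sh y = sqrt ((ch y)\<^sup>2 - 1)"
definition "rad y = hyp_dist x0 (hyp_chart y)"
definition "ct y = ch y / sh y"
definition "V y = (1 / sh y) *\<^sub>R (ch y *\<^sub>R y - fst x0)"
definition "ch' y h = snd x0 * rho y * (y \<bullet> h) - fst x0 \<bullet> h"

lemma pole_chart: "hyp_chart (fst x0) = x0"
  using pole by (rule hyp_chart_fst)

lemma chart_eq_pole: "hyp_chart y = x0 \<longleftrightarrow> y = fst x0"
  using pole_chart by (auto simp: hyp_chart_def)

lemma ch_gt_1: "y \<noteq> fst x0 \<Longrightarrow> ch y > 1"
  using minkowski_le[OF pole hyp_chart_in[of y]] chart_eq_pole[of y]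
  by (auto simp: ch_def)

lemma sh_pos: "y \<noteq> fst x0 \<Longrightarrow> sh y > 0"
  using ch_gt_1[of y] by (simp add: sh_def one_less_power)

lemma sh_sq: "y \<noteq> fst x0 \<Longrightarrow> (sh y)\<^sup>2 = (ch y)\<^sup>2 - 1"
  using ch_gt_1[of y] by (simp add: sh_def less_imp_le one_less_power)

lemma rad_pos: "y \<noteq> fst x0 \<Longrightarrow> rad y > 0"
  unfolding rad_def using hyp_dist_pos[OF pole hyp_chart_in] chart_eq_pole by metis

lemma cosh_rad: "cosh (rad y) = ch y"
  unfolding rad_def ch_def by (rule cosh_hyp_dist[OF pole hyp_chart_in])

lemma sinh_rad:
  assumes "y \<noteq> fst x0"
  shows "sinh (rad y) = sh y"
proof (rule power2_eq_imp_eq)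
  show "(sinh (rad y))\<^sup>2 = (sh y)\<^sup>2" by (simp add: sh_sq[OF assms] sinh_square_eq cosh_rad)
qed (use rad_pos[OF assms] sh_pos[OF assms] in auto)

text \<open>The function \<open>t * cosh t - sinh t\<close> vanishes at 0 and has derivative
  \<open>t * sinh t \<ge> 0\<close>, so \<open>tanh r \<le> r\<close>.\<close>

lemma rad_ct_ge_1:
  assumes "y \<noteq> fst x0"
  shows "rad y * ct y \<ge> 1"
proof -
  have "0 * cosh 0 - sinh 0 \<le> rad y * cosh (rad y) - sinh (rad y)"
  proof (rule DERIV_nonneg_imp_nondecreasing[where f = "\<lambda>t. t * cosh t - sinh t"])
    show "\<exists>D. ((\<lambda>t. t * cosh t - sinh t) has_real_derivative D) (at t) \<and> D \<ge> 0"
      if "0 \<le> t" for t :: real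
      by (rule exI[of _ "t * sinh t"]) (use that in \<open>auto intro!: derivative_eq_intros\<close>)
  qed (use rad_pos[OF assms] in simp)
  then show ?thesis using sh_pos[OF assms]
    by (simp add: ct_def cosh_rad sinh_rad[OF assms] field_simps)
qed

lemma ct_sq_ge_1:
  assumes "y \<noteq> fst x0"
  shows "(ct y)\<^sup>2 \<ge> 1"
  using sh_pos[OF assms] sh_sq[OF assms] by (simp add: ct_def power_divide field_simps)

lemma rho_pos: "rho y > 0"
  by (simp add: rho_def add_pos_nonneg)

lemma rho_sq: "(rho y)\<^sup>2 * (1 + y \<bullet> y) = 1"
proof -
  have "1 + y \<bullet> y > 0" by (simp add: add_pos_nonneg)
  then show ?thesis by (simp add: rho_def power_divide)
qed

text \<open>The formula for \<open>ch\<close> solved for \<open>snd x0\<close>. It clears the square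
  root of the chart, so that the identities below become polynomial algebra.\<close>

lemma ch_eq: "rho y * (ch y + fst x0 \<bullet> y) = snd x0"
proof -
  have "1 + y \<bullet> y > 0" by (simp add: add_pos_nonneg)
  then show ?thesis by (simp add: rho_def ch_def minkowski_def hyp_chart_def)
qed

lemma pole_sq: "(snd x0)\<^sup>2 = 1 + fst x0 \<bullet> fst x0"
  using pole by (auto simp: hyperbolic_space_def minkowski_def power2_eq_square)

lemma rho_has_derivative:
  "(rho has_derivative (\<lambda>h. - ((rho y) ^ 3) * (y \<bullet> h))) (at y)"
proof -
  have p: "1 + y \<bullet> y > 0" by (simp add: add_pos_nonneg)
  have "((\<lambda>t. 1 / sqrt (1 + t)) has_real_derivative - (rho y ^ 3 / 2)) (at (y \<bullet> y))"
  proof -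
    have "((\<lambda>t. sqrt (1 + t)) has_real_derivative inverse (sqrt (1 + y \<bullet> y)) / 2 * 1) (at (y \<bullet> y))"
      by (rule DERIV_chain2[where f = sqrt], rule DERIV_real_sqrt[OF p])
        (auto intro!: derivative_eq_intros)
    then have "((\<lambda>t. inverse (sqrt (1 + t))) has_real_derivative
        - (inverse (sqrt (1 + y \<bullet> y)) * (inverse (sqrt (1 + y \<bullet> y)) / 2 * 1)
          * inverse (sqrt (1 + y \<bullet> y)))) (at (y \<bullet> y))"
      by (rule DERIV_inverse') (use p in simp)
    then show ?thesis by (simp add: inverse_eq_divide power3_eq_cube rho_def mult_ac del: real_sqrt_mult_self)
  qed
  moreover have "((\<lambda>y. y \<bullet> y) has_derivative (\<lambda>h. 2 * (y \<bullet> h))) (at y)"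
    by (auto intro!: derivative_eq_intros simp: inner_commute)
  ultimately have "((\<lambda>y. 1 / sqrt (1 + y \<bullet> y)) has_derivative (\<lambda>h. - (rho y ^ 3 / 2) * (2 * (y \<bullet> h)))) (at y)"
    using has_derivative_compose unfolding has_field_derivative_def by blast
  then show ?thesis by (simp add: rho_def[abs_def])
qed

lemma ch_has_derivative: "(ch has_derivative ch' y) (at y)"
proof -
  have p: "1 + y \<bullet> y > 0" by (simp add: add_pos_nonneg)
  show ?thesis
    unfolding ch_def[abs_def] ch'_def[abs_def] minkowski_def hyp_chart_def rho_def using p
    by (auto intro!: derivative_eq_intros simp: inner_commute field_simps)
qed

text \<open>\<open>V\<close> is a combination of \<open>y\<close> and \<open>fst x0\<close>, so
  \<open>ch'\<close> is evaluated on these two vectors, here and in the next lemma. The relation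
  \<open>ch_eq\<close> and the hyperboloid equation eliminate the inner products.\<close>

lemma ch'_y: "ch' y y = ch y - snd x0 * rho y"
proof -
  have "ch' y y = rho y * (ch y + fst x0 \<bullet> y) * rho y * (y \<bullet> y) - fst x0 \<bullet> y"
    by (simp add: ch'_def ch_eq)
  also have "\<dots> = (ch y + fst x0 \<bullet> y) * ((rho y)\<^sup>2 * (1 + y \<bullet> y)) - (ch y + fst x0 \<bullet> y) * rho y * rho y  - fst x0 \<bullet> y"
    by (simp add: algebra_simps power2_eq_square)
  also have "\<dots> = ch y - rho y * (ch y + fst x0 \<bullet> y) * rho y"
    unfolding rho_sq by (simp add: algebra_simps)
  finally show ?thesis by (simp add: ch_eq)
qed

lemma ch'_fst: "ch' y (fst x0) = 1 - snd x0 * rho y * ch y"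
proof -
  have "ch' y (fst x0) = snd x0 * (rho y * (ch y + fst x0 \<bullet> y)) - snd x0 * rho y * ch y - fst x0 \<bullet> fst x0"
    by (simp add: ch'_def algebra_simps inner_commute)
  also have "\<dots> = (snd x0)\<^sup>2 - fst x0 \<bullet> fst x0 - snd x0 * rho y * ch y"
    by (simp add: ch_eq power2_eq_square)
  finally show ?thesis by (simp add: pole_sq)
qed

lemma ch'_linear: "linear (ch' y)"
  using ch_has_derivative by (rule has_derivative_linear)

text \<open>The argument is the hyperbolic gradient of \<open>cosh r\<close>, and its squared length
  is \<open>sinh\<^sup>2 r\<close>.\<close>

lemma ch'_scaled_field: "ch' y (ch y *\<^sub>R y - fst x0) = (ch y)\<^sup>2 - 1"
  by (simp add: linear_diff[OF ch'_linear] linear_scale[OF ch'_linear] ch'_y ch'_fst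
      algebra_simps power2_eq_square)

text \<open>Divided by \<open>sh y\<close>, this says that \<open>r\<close> grows at unit rate along
  \<open>V\<close>.\<close>

lemma ch'_V:
  assumes "y \<noteq> fst x0"
  shows "ch' y (V y) = sh y"
  unfolding V_def linear_scale[OF ch'_linear] ch'_scaled_field
  using sh_sq[OF assms] sh_pos[OF assms] by (simp add: power2_eq_square field_simps)

lemma sh_has_derivative:
  assumes "y \<noteq> fst x0"
  shows "(sh has_derivative (\<lambda>h. ct y * ch' y h)) (at y)"
proof -
  have p: "(ch y)\<^sup>2 - 1 > 0" using sh_pos[OF assms] by (simp add: sh_def)
  show ?thesis unfolding sh_def[abs_def] ct_def using p
    by (auto intro!: derivative_eq_intros ch_has_derivative simp: field_simps)
qed

lemma rad_has_derivative:
  assumes "y \<noteq> fst x0"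
  shows "(rad has_derivative (\<lambda>h. ch' y h / sh y)) (at y)"
proof -
  have p: "ch y > 1" using ch_gt_1[OF assms] .
  have "(arcosh has_real_derivative 1 / sh y) (at (ch y))"
    using p unfolding sh_def by (auto intro!: derivative_eq_intros)
  then have "((\<lambda>y. arcosh (ch y)) has_derivative (\<lambda>h. 1 / sh y * ch' y h)) (at y)"
    using has_derivative_compose[OF ch_has_derivative] unfolding has_field_derivative_def by blast
  then show ?thesis by (simp add: rad_def[abs_def] hyp_dist_def ch_def[abs_def])
qed

text \<open>The derivative of \<open>coth\<close> is \<open>- 1 / sinh\<^sup>2\<close>, and that of
  \<open>r\<close> is \<open>ch' y h / sh y\<close>; hence the cube.\<close>

lemma ct_has_derivative:
  assumes "y \<noteq> fst x0"
  shows "(ct has_derivative (\<lambda>h. - ch' y h / (sh y) ^ 3)) (at y)"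
proof -
  have p: "sh y > 0" "ch y * ch y = sh y * sh y + 1"
    using sh_pos[OF assms] sh_sq[OF assms] by (auto simp: power2_eq_square)
  have e: "- ch y * (inverse (sh y) * (ct y * h) * inverse (sh y)) + h / sh y = - h / (sh y) ^ 3" for h
  proof -
    have "- ch y * (inverse (sh y) * (ct y * h) * inverse (sh y)) + h / sh y
      = - (ch y * ch y) * h / (sh y)^3 + h / sh y"
      by (simp add: ct_def divide_inverse power3_eq_cube)
    also have "\<dots> = - h / (sh y) ^ 3"
      unfolding p(2) using p(1) by (simp add: field_simps power3_eq_cube)
    finally show ?thesis .
  qed
  show ?thesis unfolding ct_def[abs_def]
    by (rule has_derivative_eq_rhs[OF has_derivative_divide[OF ch_has_derivative sh_has_derivative[OF assms]]])
      (use p(1) e in \<open>auto simp: fun_eq_iff\<close>)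
qed

lemma continuous_on_geometry:
  "continuous_on (- {fst x0}) rho" "continuous_on (- {fst x0}) ch"
  "continuous_on (- {fst x0}) sh" "continuous_on (- {fst x0}) rad"
  "continuous_on (- {fst x0}) ct" "continuous_on (- {fst x0}) (\<lambda>y. ch' y h)"
  "continuous_on (- {fst x0}) V"
proof -
  have c: "continuous_on (- {fst x0}) f"
    if "\<And>y. y \<noteq> fst x0 \<Longrightarrow> (f has_derivative f' y) (at y)" for f :: "real^'n \<Rightarrow> real" and f'
    using that by (auto intro!: continuous_at_imp_continuous_on has_derivative_continuous)
  show [continuous_intros]: "continuous_on (- {fst x0}) rho" "continuous_on (- {fst x0}) ch"
    "continuous_on (- {fst x0}) sh" "continuous_on (- {fst x0}) rad"
    "continuous_on (- {fst x0}) ct"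
    by (rule c, rule rho_has_derivative ch_has_derivative sh_has_derivative
        rad_has_derivative ct_has_derivative, assumption?)+
  show "continuous_on (- {fst x0}) (\<lambda>y. ch' y h)"
    unfolding ch'_def by (intro continuous_intros)
  show "continuous_on (- {fst x0}) V"
    unfolding V_def using sh_pos by (intro continuous_intros) force
qed

definition "V' y h = (1 / sh y) *\<^sub>R (ch' y h *\<^sub>R y + ch y *\<^sub>R h) - (ct y * ch' y h / sh y) *\<^sub>R V y"

lemma V_has_derivative:
  assumes "y \<noteq> fst x0"
  shows "(V has_derivative V' y) (at y)"
proof -
  have s: "sh y > 0" using sh_pos[OF assms] .
  have 1: "((\<lambda>y. inverse (sh y)) has_derivative (\<lambda>h. - (inverse (sh y) * (ct y * ch' y h) * inverse (sh y)))) (at y)"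
    using s by (intro Deriv.has_derivative_inverse sh_has_derivative[OF assms]) auto
  have 2: "((\<lambda>y. ch y *\<^sub>R y - fst x0) has_derivative (\<lambda>h. ch y *\<^sub>R h + ch' y h *\<^sub>R y - 0)) (at y)"
    by (intro has_derivative_diff has_derivative_scaleR ch_has_derivative has_derivative_ident
        has_derivative_const)
  \<comment> \<open>The derivative of the factor \<open>1 / sh\<close> multiplies
    \<open>ch y *\<^sub>R y - fst x0\<close>, which is \<open>sh y *\<^sub>R V y\<close>; this is
    how \<open>V y\<close> enters \<open>V'\<close>.\<close>
  have "(V has_derivative (\<lambda>h. inverse (sh y) *\<^sub>R (ch y *\<^sub>R h + ch' y h *\<^sub>R y - 0)
      + (- (inverse (sh y) * (ct y * ch' y h) * inverse (sh y))) *\<^sub>R (ch y *\<^sub>R y - fst x0))) (at y)"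
    unfolding V_def[abs_def] divide_inverse mult_1_left by (rule has_derivative_scaleR[OF 1 2])
  then show ?thesis
    by (rule has_derivative_eq_rhs)
      (simp add: fun_eq_iff V'_def V_def divide_inverse mult_ac add.commute)
qed

lemma continuous_on_V': "continuous_on (- {fst x0}) (\<lambda>y. V' y h)"
  unfolding V'_def using sh_pos by (intro continuous_intros continuous_on_geometry) force+

section \<open>Divergence of the radial field and integration by parts\<close>

text \<open>The sum is the Euclidean divergence of \<open>V\<close>. The term with
  \<open>snd x0\<close> is an artefact of the chart and cancels once the density \<open>rho\<close>
  is differentiated along \<open>V\<close>.\<close>

lemma trace_V':
  assumes "y \<noteq> fst x0"
  shows "(\<Sum>i\<in>Basis. V' y i \<bullet> i) = real CARD('n) * ct y - snd x0 * rho y / sh y"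
proof -
  have s: "sh y > 0" using sh_pos[OF assms] .
  have lin: "(\<Sum>i\<in>Basis. ch' y i * (z \<bullet> i)) = ch' y z" for z
  proof -
    have "ch' y z = ch' y (\<Sum>i\<in>Basis. (z \<bullet> i) *\<^sub>R i)" by (simp add: euclidean_representation)
    also have "\<dots> = (\<Sum>i\<in>Basis. ch' y i * (z \<bullet> i))"
      by (simp add: linear_sum[OF ch'_linear] linear_scale[OF ch'_linear] mult.commute)
    finally show ?thesis by simp
  qed
  have "V' y i \<bullet> i = (1 / sh y) * (ch' y i * (y \<bullet> i)) + ct y - (ct y / sh y) * (ch' y i * (V y \<bullet> i))"
    if "i \<in> Basis" for i
    using that s by (simp add: V'_def inner_diff_left inner_add_left ct_def field_simps)
  then have "(\<Sum>i\<in>Basis. V' y i \<bullet> i)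
      = (\<Sum>i\<in>Basis. (1 / sh y) * (ch' y i * (y \<bullet> i)) + ct y - (ct y / sh y) * (ch' y i * (V y \<bullet> i)))"
    by (intro sum.cong refl) auto
  also have "\<dots> = (1 / sh y) * ch' y y + real CARD('n) * ct y - (ct y / sh y) * ch' y (V y)"
    by (simp only: sum_subtractf sum.distrib sum_distrib_left[symmetric] lin) simp
  also have "\<dots> = real CARD('n) * ct y - snd x0 * rho y / sh y"
    using s by (simp add: ch'_V[OF assms] ch'_y ct_def diff_divide_distrib)
  finally show ?thesis .
qed

text \<open>The derivative of \<open>rho\<close> along \<open>V\<close> is minus this quantity. Its
  \<open>snd x0\<close> part cancels the one in \<open>trace_V'\<close>, and the rest lowers the
  factor of \<open>ct\<close> from the dimension to the dimension minus 1.\<close>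

lemma rho_cube_inner_V: "rho y ^ 3 * (y \<bullet> V y) = rho y / sh y * (ch y - snd x0 * rho y)"
proof -
  have "rho y ^ 3 * (y \<bullet> (ch y *\<^sub>R y - fst x0))
      = rho y * (ch y * ((rho y)\<^sup>2 * (1 + y \<bullet> y)) - rho y * (rho y * (ch y + fst x0 \<bullet> y)))"
    by (simp add: inner_diff_right inner_commute power3_eq_cube power2_eq_square algebra_simps)
  then have "rho y ^ 3 * (y \<bullet> (ch y *\<^sub>R y - fst x0)) = rho y * (ch y - rho y * snd x0)"
    by (simp only: rho_sq ch_eq mult_1_right)
  then show ?thesis by (simp add: V_def mult.commute)
qed

text \<open>The integrand is the Euclidean divergence of the field \<open>g rho V\<close>, which
  vanishes off \<open>K\<close>: each component, differentiated in its own direction, integrates to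
  0.\<close>

lemma radial_integration_by_parts:
  fixes g :: "real^'n \<Rightarrow> real"
  assumes K: "compact K" "fst x0 \<notin> K"
    and g: "\<And>y. y \<noteq> fst x0 \<Longrightarrow> (g has_derivative g' y) (at y)"
    and g': "\<And>h. continuous_on (- {fst x0}) (\<lambda>y. g' y h)"
    and zero: "\<And>y. y \<notin> K \<Longrightarrow> g y = 0"
  shows "(LINT y:K|lborel. rho y * (g' y (V y) + (real CARD('n) - 1) * ct y * g y)) = 0"
proof -
  have KU: "K \<subseteq> - {fst x0}" using K by auto
  define Z' where "Z' y h = rho y *\<^sub>R V' y h + (- (rho y ^ 3) * (y \<bullet> h)) *\<^sub>R V y" for y h
  have Z: "((\<lambda>y. rho y *\<^sub>R V y) has_derivative Z' y) (at y)" if "y \<noteq> fst x0" for y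
    unfolding Z'_def by (rule has_derivative_scaleR[OF rho_has_derivative V_has_derivative[OF that]])
  \<comment> \<open>The derivative in direction \<open>h\<close> of the component of
    \<open>g rho V\<close> along \<open>i\<close>; the divergence takes
    \<open>h = i\<close>.\<close>
  define d where "d i y h = g y * (Z' y h \<bullet> i) + g' y h * ((rho y *\<^sub>R V y) \<bullet> i)" for i y h
  have d: "((\<lambda>y. g y * ((rho y *\<^sub>R V y) \<bullet> i)) has_derivative d i y) (at y)" if "y \<noteq> fst x0" for y i
    unfolding d_def
    by (intro has_derivative_mult g that has_derivative_inner_left Z)
  have cg: "continuous_on (- {fst x0}) g"
    using g by (auto intro!: continuous_at_imp_continuous_on has_derivative_continuous)
  have cd: "continuous_on (- {fst x0}) (\<lambda>y. d i y h)" for i h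
    unfolding d_def Z'_def
    by (intro continuous_intros cg g' continuous_on_geometry continuous_on_V')
  have int: "integrable lborel (\<lambda>y. indicat_real K y *\<^sub>R d i y i)" for i
    using K(1) by (rule borel_integrable_compact) (rule continuous_on_subset[OF cd KU])
  have 0: "(LINT y:K|lborel. d i y i) = 0" for i
    using K(1) KU d cd zero
    by (intro set_integral_directional_derivative_eq_0[of "- {fst x0}" K
          "\<lambda>y. g y * ((rho y *\<^sub>R V y) \<bullet> i)"]) auto
  have trace: "(\<Sum>i\<in>Basis. d i y i) = rho y * (g' y (V y) + (real CARD('n) - 1) * ct y * g y)"
    if "y \<in> K" for y
  proof -
    have y: "y \<noteq> fst x0" using that K by auto
    have lin: "linear (g' y)" using g[OF y] by (rule has_derivative_linear)
    have "g' y (V y) = g' y (\<Sum>i\<in>Basis. (V y \<bullet> i) *\<^sub>R i)" by (simp add: euclidean_representation)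
    also have "\<dots> = (\<Sum>i\<in>Basis. g' y i * (V y \<bullet> i))"
      by (simp add: linear_sum[OF lin] linear_scale[OF lin] mult.commute)
    finally have 1: "(\<Sum>i\<in>Basis. g' y i * (V y \<bullet> i)) = g' y (V y)" by simp
    have 2: "(\<Sum>i\<in>Basis. (y \<bullet> i) * (V y \<bullet> i)) = y \<bullet> V y"
      by (simp add: euclidean_inner[of y "V y"])
    have "(\<Sum>i\<in>Basis. d i y i) = (\<Sum>i\<in>Basis. (g y * rho y) * (V' y i \<bullet> i)
        - (g y * rho y ^ 3) * ((y \<bullet> i) * (V y \<bullet> i)) + rho y * (g' y i * (V y \<bullet> i)))"
      by (intro sum.cong refl) (simp add: d_def Z'_def inner_add_left algebra_simps)
    also have "\<dots> = g y * rho y * (real CARD('n) * ct y - snd x0 * rho y / sh y)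
        - g y * (rho y ^ 3 * (y \<bullet> V y)) + rho y * g' y (V y)"
      by (simp add: sum.distrib sum_subtractf sum_distrib_left[symmetric] 1 2 trace_V'[OF y])
    also have "\<dots> = rho y * (g' y (V y) + (real CARD('n) - 1) * ct y * g y)"
      unfolding rho_cube_inner_V using sh_pos[OF y] by (simp add: ct_def field_simps)
    finally show ?thesis .
  qed
  have "(LINT y:K|lborel. rho y * (g' y (V y) + (real CARD('n) - 1) * ct y * g y))
      = (LINT y|lborel. (\<Sum>i\<in>Basis. indicat_real K y *\<^sub>R d i y i))"
    unfolding set_lebesgue_integral_def
    by (intro Bochner_Integration.integral_cong refl)
      (simp add: indicator_def trace flip: sum_distrib_left)
  also have "\<dots> = (\<Sum>i\<in>Basis. LINT y:K|lborel. d i y i)"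
    unfolding set_lebesgue_integral_def by (rule Bochner_Integration.integral_sum) (rule int)
  finally show ?thesis by (simp add: 0)
qed

section \<open>Radial derivatives and volume integrals in the chart\<close>

text \<open>In the chart, the geodesic from the pole through \<open>hyp_chart y\<close> passes
  \<open>y\<close> with velocity \<open>V y\<close>, and the chain rule applies. Since
  \<open>u\<close> and \<open>g\<close> are compared only off the pole, \<open>u\<close> may itself
  be a radial derivative.\<close>

lemma radial_deriv_chart:
  assumes y: "y \<noteq> fst x0" and g: "(g has_derivative g') (at y)"
    and u: "\<And>z. z \<noteq> fst x0 \<Longrightarrow> u (hyp_chart z) = g z"
  shows "radial_deriv x0 u (hyp_chart y) = g' (V y)"
proof -
  define v where "v = hyp_direction x0 (hyp_chart y)"
  have ne: "hyp_chart y \<noteq> x0" using y by (simp add: chart_eq_pole)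
  note hp = hyp_polar_direction[OF pole hyp_chart_in ne, folded v_def rad_def]
  define p where "p r = fst (hyp_polar x0 r v)" for r
  have py: "p (rad y) = y" using hp(1) by (simp add: p_def hyp_chart_def)
  have s: "sh y > 0" using sh_pos[OF y] .
  have v: "fst v = (1 / sh y) *\<^sub>R (y - ch y *\<^sub>R fst x0)"
    unfolding v_def hyp_direction_def rad_def[symmetric] cosh_rad sinh_rad[OF y]
    by (simp add: hyp_chart_def)
  \<comment> \<open>The left side is the velocity \<open>sinh r x0 + cosh r v\<close> of the
    geodesic, projected to the chart.\<close>
  have vd: "sh y *\<^sub>R fst x0 + ch y *\<^sub>R fst v = V y"
  proof -
    have "sh y *\<^sub>R (sh y *\<^sub>R fst x0 + ch y *\<^sub>R fst v) = (sh y)\<^sup>2 *\<^sub>R fst x0 + ch y *\<^sub>R (y - ch y *\<^sub>R fst x0)"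
      using s by (simp add: v scaleR_add_right power2_eq_square)
    also have "\<dots> = ch y *\<^sub>R y - fst x0"
      unfolding sh_sq[OF y] by (simp add: algebra_simps power2_eq_square)
    also have "\<dots> = sh y *\<^sub>R V y" using s by (simp add: V_def)
    finally show ?thesis using s by simp
  qed
  have "(p has_vector_derivative sinh (rad y) *\<^sub>R fst x0 + cosh (rad y) *\<^sub>R fst v) (at (rad y))"
    unfolding p_def hyp_polar_def by (auto intro!: derivative_eq_intros)
  then have pd: "(p has_vector_derivative V y) (at (rad y))"
    by (simp add: sinh_rad[OF y] cosh_rad vd)
  have "((\<lambda>r. g (p r)) has_derivative (\<lambda>t. g' (t *\<^sub>R V y))) (at (rad y))"
    using has_derivative_compose[OF pd[unfolded has_vector_derivative_def]] g py by simp
  then have "((\<lambda>r. g (p r)) has_derivative (\<lambda>t. g' (V y) * t)) (at (rad y))"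
    by (simp add: linear_scale[OF has_derivative_linear[OF g]] mult.commute)
  \<comment> \<open>For positive \<open>r\<close> the geodesic avoids the pole, where
    \<open>u\<close> and \<open>g\<close> may differ; these \<open>r\<close> form a neighbourhood of
    \<open>rad y\<close>.\<close>
  moreover have "g (p r) = u (hyp_polar x0 r v)" if "r \<in> {0<..}" for r
  proof -
    note pr = hyp_polar_in[OF pole hp(2,3), of r]
    have "hyp_polar x0 r v \<noteq> x0"
    proof
      assume "hyp_polar x0 r v = x0"
      then have "cosh r = 1"
        using pr(2) that cosh_hyp_dist[OF pole pole] pole by (simp add: hyperbolic_space_def)
      then show False using that cosh_real_one_iff[of r] by simp
    qed
    moreover have eq: "hyp_chart (p r) = hyp_polar x0 r v"
      unfolding p_def using pr(1) that by (simp add: hyp_chart_fst)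
    ultimately show ?thesis using u[of "p r"] chart_eq_pole[of "p r"] by auto
  qed
  ultimately have "((\<lambda>r. u (hyp_polar x0 r v)) has_derivative (\<lambda>t. g' (V y) * t)) (at (rad y))"
    using has_derivative_transform_within_open[of _ _ "rad y" UNIV "{0<..}"] rad_pos[OF y]
    by (metis (no_types, lifting) greaterThan_iff open_greaterThan)
  then show ?thesis
    unfolding radial_deriv_def v_def[symmetric] rad_def[symmetric]
    by (intro DERIV_imp_deriv) (simp add: has_field_derivative_def)
qed

text \<open>By the determinant of the metric the volume has density \<open>rho\<close> in the chart.
  The pole is a null set, so \<open>\<phi>\<close> may have any value there.\<close>

lemma integral_hyp_volume:
  assumes K: "compact K" "fst x0 \<notin> K"
    and psi: "continuous_on (- {fst x0}) \<psi>" "\<And>y. y \<notin> K \<Longrightarrow> y \<noteq> fst x0 \<Longrightarrow> \<psi> y = 0"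
    and eq: "\<And>y. y \<noteq> fst x0 \<Longrightarrow> \<phi> (hyp_chart y) = \<psi> y"
  shows "(LINT x|hyp_volume. \<phi> x) = (LINT y:K|lborel. rho y * \<psi> y)"
proof -
  have KU: "K \<subseteq> - {fst x0}" using K by auto
  have "integrable lborel (\<lambda>y. indicat_real K y *\<^sub>R \<psi> y)"
    using K(1) by (rule borel_integrable_compact) (rule continuous_on_subset[OF psi(1) KU])
  then have pK [measurable]: "(\<lambda>y. indicat_real K y *\<^sub>R \<psi> y) \<in> borel_measurable borel"
    using borel_measurable_integrable by fastforce
  \<comment> \<open>A measurable function altered at a single point is still measurable.\<close>
  have chart_eq: "(\<lambda>y. \<phi> (hyp_chart y))
      = (\<lambda>y. if y = fst x0 then \<phi> x0 else indicat_real K y *\<^sub>R \<psi> y)"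
    using eq psi(2) pole_chart by (force simp: indicator_def)
  have pm [measurable]: "(\<lambda>y. \<phi> (hyp_chart y)) \<in> borel_measurable borel"
    unfolding chart_eq by measurable
  have rho_m [measurable]: "rho \<in> borel_measurable borel"
    using rho_has_derivative
    by (intro borel_measurable_continuous_onI continuous_at_imp_continuous_on ballI)
      (rule has_derivative_continuous)
  have "(hyp_chart :: real^'n \<Rightarrow> _) \<in> borel \<rightarrow>\<^sub>M borel"
    unfolding hyp_chart_def[abs_def]
    by (intro borel_measurable_continuous_onI continuous_intros)
  then have cm: "(hyp_chart :: real^'n \<Rightarrow> _) \<in> borel \<rightarrow>\<^sub>M restrict_space borel hyperbolic_space"
    by (intro measurable_restrict_space2) (auto intro: hyp_chart_in)
  \<comment> \<open>On the hyperboloid \<open>hyp_chart\<close> inverts \<open>fst\<close>, which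
    carries measurability from the chart back to \<open>\<phi>\<close>.\<close>
  have "(\<lambda>x. \<phi> (hyp_chart (fst x))) \<in> borel_measurable (restrict_space borel hyperbolic_space)"
    by (intro measurable_restrict_space1 measurable_compose[OF _ pm]
        borel_measurable_continuous_onI continuous_intros)
  then have phi: "\<phi> \<in> borel_measurable (restrict_space borel hyperbolic_space)"
    by (rule measurable_cong[THEN iffD1, rotated]) (simp add: space_restrict_space hyp_chart_fst)
  have dens: "sqrt (det (hyp_metric y)) = rho y" for y :: "real^'n"
    by (simp add: det_hyp_metric rho_def real_sqrt_divide)
  have "(LINT x|hyp_volume. \<phi> x)
      = (LINT y|density lborel (\<lambda>y. ennreal (rho y)). \<phi> (hyp_chart y))"
    unfolding hyp_volume_def dens using cm phi by (intro integral_distr) simp_all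
  also have "\<dots> = (LINT y|lborel. rho y *\<^sub>R \<phi> (hyp_chart y))"
    using rho_pos by (intro integral_density) (auto intro: less_imp_le)
  also have "\<dots> = (LINT y|lborel. indicat_real K y *\<^sub>R (rho y * \<psi> y))"
  proof (rule integral_cong_AE)
    have "AE y in lborel. y \<noteq> fst x0" by (rule AE_lborel_singleton)
    then show "AE y in lborel. rho y *\<^sub>R \<phi> (hyp_chart y) = indicat_real K y *\<^sub>R (rho y * \<psi> y)"
      by eventually_elim (auto simp: eq psi(2) indicator_def)
    have "(\<lambda>y. indicat_real K y *\<^sub>R (rho y * \<psi> y)) = (\<lambda>y. rho y * (indicat_real K y *\<^sub>R \<psi> y))"
      by (auto simp: fun_eq_iff)
    then show "(\<lambda>y. indicat_real K y *\<^sub>R (rho y * \<psi> y)) \<in> borel_measurable lborel"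
      using borel_measurable_times[OF rho_m pK] by simp
  qed simp
  finally show ?thesis by (simp add: set_lebesgue_integral_def)
qed

section \<open>The inequality in the chart\<close>

text \<open>\<open>F\<close> plays the role of the first and \<open>G\<close> of the second radial
  derivative. Every integral is expanded into seven moments \<open>A\<close> to \<open>Q\<close>,
  which two integrations by parts relate linearly.\<close>

lemma radial_uncertainty_chart:
  fixes F :: "real^'n \<Rightarrow> real"
  defines "n \<equiv> real CARD('n) - 1"
  assumes K: "compact K" "fst x0 \<notin> K"
    and F: "\<And>y. y \<noteq> fst x0 \<Longrightarrow> (F has_derivative F' y) (at y)"
    and F': "\<And>h. continuous_on (- {fst x0}) (\<lambda>y. F' y h)"
    and G: "\<And>y. G y = F' y (V y)" "continuous_on (- {fst x0}) G"
    and zero: "\<And>y. y \<notin> K \<Longrightarrow> F y = 0"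
    and lam: "0 \<le> lam" "lam \<le> (n / 2)\<^sup>2"
  shows "(LINT y:K|lborel. rho y * ((G y + n * ct y * F y)\<^sup>2 - lam * (F y)\<^sup>2))
      * (LINT y:K|lborel. rho y * ((rad y)\<^sup>2 * (F y)\<^sup>2))
    \<ge> (h_const CARD('n) lam)\<^sup>2 * (LINT y:K|lborel. rho y * (F y)\<^sup>2)\<^sup>2"
proof -
  define I where "I \<phi> = (LINT y:K|lborel. rho y * \<phi> y)" for \<phi>
  have KU: "K \<subseteq> - {fst x0}" using K by auto
  have cF: "continuous_on (- {fst x0}) F"
    using F by (auto intro!: continuous_at_imp_continuous_on has_derivative_continuous)
  note cont = continuous_on_geometry(1,4,5) cF G(2)
  have int: "set_integrable lborel K (\<lambda>y. rho y * \<phi> y)" if "continuous_on (- {fst x0}) \<phi>" for \<phi>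
    unfolding set_integrable_def using K(1)
    by (rule borel_integrable_compact)
      (intro continuous_intros continuous_on_subset[OF _ KU] that continuous_on_geometry)
  have I_add: "I (\<lambda>y. \<phi> y + \<psi> y) = I \<phi> + I \<psi>"
    if "continuous_on (- {fst x0}) \<phi>" "continuous_on (- {fst x0}) \<psi>" for \<phi> \<psi>
    unfolding I_def using set_integral_add(2)[OF int int, OF that] by (simp add: distrib_left)
  have I_scale: "I (\<lambda>y. c * \<phi> y) = c * I \<phi>" for c \<phi>
    unfolding I_def set_integral_mult_right[symmetric] by (simp add: mult.left_commute)
  have I_mono: "I \<phi> \<le> I \<psi>"
    if "continuous_on (- {fst x0}) \<phi>" "continuous_on (- {fst x0}) \<psi>" "\<And>y. y \<in> K \<Longrightarrow> \<phi> y \<le> \<psi> y"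
    for \<phi> \<psi>
    unfolding I_def using that rho_pos
    by (intro set_integral_mono int) (auto intro!: mult_left_mono less_imp_le)
  define A where "A = I (\<lambda>y. (G y)\<^sup>2)"
  define B where "B = I (\<lambda>y. ct y * F y * G y)"
  define C where "C = I (\<lambda>y. (ct y)\<^sup>2 * (F y)\<^sup>2)"
  define D where "D = I (\<lambda>y. (F y)\<^sup>2)"
  define H where "H = I (\<lambda>y. rad y * F y * G y)"
  define J where "J = I (\<lambda>y. rad y * ct y * (F y)\<^sup>2)"
  define Q where "Q = I (\<lambda>y. (rad y)\<^sup>2 * (F y)\<^sup>2)"
  have D0: "D \<ge> 0" and CD: "C \<ge> D" and JD: "J \<ge> D" and Q0: "Q \<ge> 0"
  proof -
    have yK: "y \<noteq> fst x0" if "y \<in> K" for y using that K by auto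
    have I0: "I (\<lambda>_. 0) = 0" by (simp add: I_def)
    have "I (\<lambda>_. 0) \<le> D" unfolding D_def by (intro I_mono continuous_intros cont) simp
    then show "D \<ge> 0" by (simp add: I0)
    have "I (\<lambda>_. 0) \<le> Q" unfolding Q_def by (intro I_mono continuous_intros cont) simp
    then show "Q \<ge> 0" by (simp add: I0)
    show "C \<ge> D" unfolding D_def C_def
      by (intro I_mono continuous_intros cont)
        (use mult_right_mono[OF ct_sq_ge_1[OF yK]] in fastforce)
    show "J \<ge> D" unfolding D_def J_def
      by (intro I_mono continuous_intros cont)
        (use mult_right_mono[OF rad_ct_ge_1[OF yK]] in fastforce)
  qed
  \<comment> \<open>Integration by parts for \<open>rad F\<^sup>2\<close>; \<open>rad\<close> has
    derivative 1 along \<open>V\<close>, which produces \<open>D\<close>.\<close>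
  have rad_identity: "D + 2 * H + n * J = 0"
  proof -
    let ?g' = "\<lambda>y h. rad y * (2 * F y * F' y h) + (ch' y h / sh y) * (F y)\<^sup>2"
    have "(LINT y:K|lborel. rho y * (?g' y (V y) + (real CARD('n) - 1) * ct y * (rad y * (F y)\<^sup>2))) = 0"
    proof (rule radial_integration_by_parts[OF K])
      show "((\<lambda>y. rad y * (F y)\<^sup>2) has_derivative ?g' y) (at y)" if "y \<noteq> fst x0" for y
        by (rule has_derivative_eq_rhs[OF has_derivative_mult[OF rad_has_derivative[OF that]
                has_derivative_power[OF F[OF that]]]]) (simp add: mult_ac)
      show "continuous_on (- {fst x0}) (\<lambda>y. ?g' y h)" for h
        using sh_pos by (intro continuous_intros cF F' continuous_on_geometry) force
    qed (simp add: zero)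
    also have "(LINT y:K|lborel. rho y * (?g' y (V y) + (real CARD('n) - 1) * ct y * (rad y * (F y)\<^sup>2)))
        = I (\<lambda>y. (F y)\<^sup>2 + (2 * (rad y * F y * G y) + n * (rad y * ct y * (F y)\<^sup>2)))"
      unfolding I_def
    proof (rule set_lebesgue_integral_cong)
      show "\<forall>y. y \<in> K \<longrightarrow> rho y * (?g' y (V y) + (real CARD('n) - 1) * ct y * (rad y * (F y)\<^sup>2))
          = rho y * ((F y)\<^sup>2 + (2 * (rad y * F y * G y) + n * (rad y * ct y * (F y)\<^sup>2)))"
      proof (intro allI impI)
        fix y assume "y \<in> K"
        then have "y \<noteq> fst x0" using K by auto
        then show "rho y * (?g' y (V y) + (real CARD('n) - 1) * ct y * (rad y * (F y)\<^sup>2))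
          = rho y * ((F y)\<^sup>2 + (2 * (rad y * F y * G y) + n * (rad y * ct y * (F y)\<^sup>2)))"
          using sh_pos[of y] by (simp add: ch'_V G(1) n_def algebra_simps)
      qed
    qed (use K(1) in \<open>simp add: compact_imp_closed\<close>)
    also have "\<dots> = D + (2 * H + n * J)"
      unfolding D_def H_def J_def I_scale[symmetric]
      by (subst I_add I_add; (intro continuous_intros cont)?)+ simp
    finally show ?thesis by simp
  qed
  \<comment> \<open>Integration by parts for \<open>ct F\<^sup>2\<close>. The derivative of
    \<open>coth\<close> is \<open>1 - coth\<^sup>2\<close>: it produces \<open>D\<close> and lowers
    the factor of \<open>C\<close> from \<open>n\<close> to \<open>n - 1\<close>.\<close>
  have ct_identity: "D + 2 * B + (n - 1) * C = 0"
  proof -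
    let ?g' = "\<lambda>y h. ct y * (2 * F y * F' y h) + (- ch' y h / (sh y) ^ 3) * (F y)\<^sup>2"
    have "(LINT y:K|lborel. rho y * (?g' y (V y) + (real CARD('n) - 1) * ct y * (ct y * (F y)\<^sup>2))) = 0"
    proof (rule radial_integration_by_parts[OF K])
      show "((\<lambda>y. ct y * (F y)\<^sup>2) has_derivative ?g' y) (at y)" if "y \<noteq> fst x0" for y
        by (rule has_derivative_eq_rhs[OF has_derivative_mult[OF ct_has_derivative[OF that]
                has_derivative_power[OF F[OF that]]]]) (simp add: mult_ac)
      show "continuous_on (- {fst x0}) (\<lambda>y. ?g' y h)" for h
        using sh_pos by (intro continuous_intros cF F' continuous_on_geometry) force
    qed (simp add: zero)
    also have "(LINT y:K|lborel. rho y * (?g' y (V y) + (real CARD('n) - 1) * ct y * (ct y * (F y)\<^sup>2)))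
        = I (\<lambda>y. (F y)\<^sup>2 + (2 * (ct y * F y * G y) + (n - 1) * ((ct y)\<^sup>2 * (F y)\<^sup>2)))"
      unfolding I_def
    proof (rule set_lebesgue_integral_cong)
      show "\<forall>y. y \<in> K \<longrightarrow> rho y * (?g' y (V y) + (real CARD('n) - 1) * ct y * (ct y * (F y)\<^sup>2))
          = rho y * ((F y)\<^sup>2 + (2 * (ct y * F y * G y) + (n - 1) * ((ct y)\<^sup>2 * (F y)\<^sup>2)))"
      proof (intro allI impI)
        fix y assume "y \<in> K"
        then have y: "y \<noteq> fst x0" using K by auto
        have e: "- sh y / (sh y) ^ 3 = 1 - (ct y)\<^sup>2"
          using sh_pos[OF y] sh_sq[OF y]
          by (simp add: ct_def power_divide field_simps power2_eq_square power3_eq_cube)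
        show "rho y * (?g' y (V y) + (real CARD('n) - 1) * ct y * (ct y * (F y)\<^sup>2))
          = rho y * ((F y)\<^sup>2 + (2 * (ct y * F y * G y) + (n - 1) * ((ct y)\<^sup>2 * (F y)\<^sup>2)))"
          unfolding ch'_V[OF y] e by (simp add: G(1) n_def algebra_simps power2_eq_square)
      qed
    qed (use K(1) in \<open>simp add: compact_imp_closed\<close>)
    also have "\<dots> = D + (2 * B + (n - 1) * C)"
      unfolding D_def B_def C_def I_scale[symmetric]
      by (subst I_add I_add; (intro continuous_intros cont)?)+ simp
    finally show ?thesis by simp
  qed
  define s where "s = sqrt (n\<^sup>2 - 4 * lam)"
  \<comment> \<open>The smaller root of \<open>b * (n - b) = lam\<close>.\<close>
  define b where "b = (n - s) / 2"
  have n: "n \<ge> 0" by (simp add: n_def)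
  have s: "s \<ge> 0" "s\<^sup>2 = n\<^sup>2 - 4 * lam" using lam by (simp_all add: s_def power_divide)
  have "s\<^sup>2 \<le> n\<^sup>2" using s(2) lam(1) by linarith
  then have sn: "s \<le> n" using n by (rule power2_le_imp_le)
  have b: "b \<ge> 0" "n - b \<ge> 0" "b * (n - b) = lam" "n - 2 * b = s"
  proof -
    show "b \<ge> 0" "n - b \<ge> 0" "n - 2 * b = s" using s(1) sn by (simp_all add: b_def field_simps)
    have "b * (n - b) = (n\<^sup>2 - s\<^sup>2) / 4" by (simp add: b_def power2_eq_square field_simps)
    then show "b * (n - b) = lam" using s(2) by simp
  qed
  define E where "E = I (\<lambda>y. (G y + n * ct y * F y)\<^sup>2 - lam * (F y)\<^sup>2)"
  \<comment> \<open>\<open>P\<close> is the integral of \<open>(G + b ct F)\<^sup>2\<close> and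
    \<open>R\<close> that of \<open>rad F (G + b ct F)\<close>, in terms of the moments.\<close>
  define P where "P = A + 2 * b * B + b\<^sup>2 * C"
  define R where "R = H + b * J"
  have E: "E = A + 2 * n * B + n\<^sup>2 * C - lam * D"
  proof -
    have "E = I (\<lambda>y. (G y)\<^sup>2 + ((2 * n) * (ct y * F y * G y)
        + (n\<^sup>2 * ((ct y)\<^sup>2 * (F y)\<^sup>2) + (- lam) * (F y)\<^sup>2)))"
      unfolding E_def by (intro arg_cong[where f = I] ext) (simp add: power2_eq_square algebra_simps)
    also have "\<dots> = A + ((2 * n) * B + (n\<^sup>2 * C + (- lam) * D))"
      unfolding A_def B_def C_def D_def I_scale[symmetric]
      by (subst I_add I_add I_add; (intro continuous_intros cont)?)+ simp
    finally show ?thesis by simp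
  qed
  \<comment> \<open>The integral of \<open>(G + b ct F + t rad F)\<^sup>2\<close> as a quadratic
    polynomial in \<open>t\<close>; its discriminant gives the Cauchy-Schwarz inequality.\<close>
  have quad: "0 \<le> P + 2 * t * R + t\<^sup>2 * Q" for t
  proof -
    have "0 = I (\<lambda>_. 0)" by (simp add: I_def)
    also have "\<dots> \<le> I (\<lambda>y. (G y + b * ct y * F y + t * rad y * F y)\<^sup>2)"
      by (intro I_mono continuous_intros cont) simp
    also have "\<dots> = I (\<lambda>y. (G y)\<^sup>2 + ((2 * b) * (ct y * F y * G y)
        + (b\<^sup>2 * ((ct y)\<^sup>2 * (F y)\<^sup>2) + ((2 * t) * (rad y * F y * G y)
        + ((2 * t * b) * (rad y * ct y * (F y)\<^sup>2) + t\<^sup>2 * ((rad y)\<^sup>2 * (F y)\<^sup>2))))))"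
      by (intro arg_cong[where f = I] ext) (simp add: power2_eq_square algebra_simps)
    also have "\<dots> = A + ((2 * b) * B + (b\<^sup>2 * C + ((2 * t) * H + ((2 * t * b) * J + t\<^sup>2 * Q))))"
      unfolding A_def B_def C_def H_def J_def Q_def I_scale[symmetric]
      by (subst I_add I_add I_add I_add I_add; (intro continuous_intros cont)?)+ simp
    finally show ?thesis by (simp add: P_def R_def algebra_simps)
  qed
  have PQ: "R\<^sup>2 \<le> P * Q"
  proof (cases "Q = 0")
    case True
    have "R = 0"
    proof (rule ccontr)
      assume "R \<noteq> 0"
      \<comment> \<open>For \<open>Q = 0\<close> the polynomial is affine, and this \<open>t\<close>
        gives it the value -1.\<close>
      then show False using quad[of "- (P + 1) / (2 * R)"] True by (simp add: field_simps)
    qed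
    then show ?thesis using True by simp
  next
    case False
    \<comment> \<open>The value of the polynomial at its minimum \<open>t = - R / Q\<close>.\<close>
    then have "P - R\<^sup>2 / Q \<ge> 0"
      using quad[of "- R / Q"] by (simp add: field_simps power2_eq_square)
    then show ?thesis using False Q0 by (simp add: field_simps)
  qed
  have "E - P = (n - b) * (2 * B + (n + b) * C - b * D)"
    unfolding E P_def b(3)[symmetric] by (simp add: algebra_simps power2_eq_square)
  \<comment> \<open>Eliminating \<open>B\<close> leaves
    \<open>E - P = (n - b) * (1 + b) * (C - D)\<close>, a product of nonnegative factors.\<close>
  also have "2 * B + (n + b) * C - b * D = (1 + b) * (C - D)"
    using ct_identity by (simp add: algebra_simps)
  finally have EP: "P \<le> E"
    using b CD by (smt (verit) mult_nonneg_nonneg)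
  have h: "h_const CARD('n) lam = (s + 1) / 2" by (simp add: h_const_def n_def s_def)
  have "2 * R = - D - s * J"
    using rad_identity unfolding R_def b(4)[symmetric] by (simp add: algebra_simps)
  \<comment> \<open>From \<open>J \<ge> D\<close> it follows that
    \<open>- 2 * R = D + s * J \<ge> (1 + s) * D\<close>; this is where the constant arises.\<close>
  then have "h_const CARD('n) lam * D \<le> - R"
    using mult_left_mono[OF JD s(1)] by (simp add: h algebra_simps)
  moreover have "0 \<le> h_const CARD('n) lam * D"
    using s(1) D0 by (simp add: h)
  ultimately have "(h_const CARD('n) lam * D)\<^sup>2 \<le> R\<^sup>2"
    by (metis power2_minus power_mono)
  also have "\<dots> \<le> P * Q" by (rule PQ)
  also have "\<dots> \<le> E * Q" using EP Q0 by (rule mult_right_mono)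
  finally show ?thesis
    by (simp add: E_def Q_def D_def I_def power_mult_distrib)
qed

section \<open>From test functions on the hyperboloid to the chart\<close>

lemma radial_uncertainty:
  fixes u :: "(real^'n) \<times> real \<Rightarrow> real"
  assumes u: "u \<in> test_functions x0"
    and lam: "0 \<le> lam" "lam \<le> ((real CARD('n) - 1) / 2)\<^sup>2"
  shows "(LINT x|hyp_volume. (radial_laplacian x0 u x)\<^sup>2
          - lam * minkowski (radial_gradient x0 u x) (radial_gradient x0 u x))
      * (LINT x|hyp_volume. (hyp_dist x0 x)\<^sup>2
          * minkowski (radial_gradient x0 u x) (radial_gradient x0 u x))
      \<ge> (h_const CARD('n) lam)\<^sup>2
        * (LINT x|hyp_volume. minkowski (radial_gradient x0 u x) (radial_gradient x0 u x))\<^sup>2"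
proof -
  have U: "hyp_chart -` (hyperbolic_space - {x0}) = - {fst x0}"
    by (rule set_eqI) (simp add: hyp_chart_in chart_eq_pole)
  have UO: "open (- {fst x0})" by auto
  obtain K0 where K0: "compact K0" "K0 \<subseteq> hyperbolic_space - {x0}"
    "\<And>x. x \<in> hyperbolic_space - {x0} - K0 \<Longrightarrow> u x = 0"
    using u by (auto simp: test_functions_def)
  \<comment> \<open>The projection \<open>fst\<close> inverts the chart, so \<open>K\<close> is the
    compact set \<open>K0\<close> seen in the chart.\<close>
  define K where "K = fst ` K0"
  have K: "compact K"
    unfolding K_def by (intro compact_continuous_image K0 continuous_intros)
  have aK: "fst x0 \<notin> K"
  proof
    assume "fst x0 \<in> K"
    then obtain x where "x \<in> K0" "fst x = fst x0" by (auto simp: K_def)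
    then show False using K0(2) hyp_chart_fst pole_chart by (metis Diff_iff insertI1 subsetD)
  qed
  define w where "w = u \<circ> hyp_chart"
  define p where "p i y = frechet_derivative w (at y) (axis i 1)" for i y
  define q where "q i j y = frechet_derivative (p i) (at y) (axis j 1)" for i j y
  \<comment> \<open>Order 2 makes the first partials \<open>p\<close> differentiable and the second
    partials \<open>q\<close> continuous, as the radial Laplacian demands.\<close>
  have "Ck_on (Suc (Suc 0)) (- {fst x0}) w"
    using u unfolding test_functions_def U w_def by blast
  then have w: "w differentiable (at y)" and p: "p i differentiable (at y)" if "y \<noteq> fst x0" for y i
    using that by (auto simp: p_def[abs_def])
  have q: "continuous_on (- {fst x0}) (q i j)" for i j
    using \<open>Ck_on (Suc (Suc 0)) (- {fst x0}) w\<close> by (simp add: p_def[abs_def] q_def[abs_def])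
  have cp: "continuous_on (- {fst x0}) (p i)" for i
    using p by (auto intro!: continuous_at_imp_continuous_on differentiable_imp_continuous_within)
  have expand: "frechet_derivative f (at y) h = (\<Sum>i\<in>UNIV. h $ i * frechet_derivative f (at y) (axis i 1))"
    if "f differentiable (at y)" for f :: "real^'n \<Rightarrow> real" and y h
  proof -
    have lin: "linear (frechet_derivative f (at y))" using that by (rule linear_frechet_derivative)
    have "frechet_derivative f (at y) (\<Sum>i\<in>UNIV. h $ i *\<^sub>R axis i 1)
        = (\<Sum>i\<in>UNIV. h $ i * frechet_derivative f (at y) (axis i 1))"
      by (simp add: linear_sum[OF lin] linear_scale[OF lin])
    moreover have "(\<Sum>i\<in>UNIV. h $ i *\<^sub>R axis i 1) = h"
      using basis_expansion[of h] by (simp add: scalar_mult_eq_scaleR)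
    ultimately show ?thesis by simp
  qed
  \<comment> \<open>The derivative of \<open>w\<close> along \<open>V\<close>, written with partials
    so that it can be differentiated again.\<close>
  define F where "F y = (\<Sum>i\<in>UNIV. V y $ i * p i y)" for y
  define F' where "F' y h = (\<Sum>i\<in>UNIV. V y $ i * frechet_derivative (p i) (at y) h + V' y h $ i * p i y)"
    for y h
  define G where "G y = F' y (V y)" for y
  have F: "(F has_derivative F' y) (at y)" if "y \<noteq> fst x0" for y
  proof -
    have "((\<lambda>y. V y $ i) has_derivative (\<lambda>h. V' y h $ i)) (at y)" for i
      by (rule bounded_linear.has_derivative[OF bounded_linear_vec_nth V_has_derivative[OF that]])
    moreover have "(p i has_derivative frechet_derivative (p i) (at y)) (at y)" for i
      using p[OF that] by (simp add: frechet_derivative_works)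
    ultimately have "((\<lambda>y. V y $ i * p i y) has_derivative
        (\<lambda>h. V y $ i * frechet_derivative (p i) (at y) h + V' y h $ i * p i y)) (at y)" for i
      by (rule has_derivative_mult)
    then show ?thesis
      unfolding F_def[abs_def] F'_def[abs_def] by (rule has_derivative_sum)
  qed
  \<comment> \<open>The coordinate expansion reduces continuity of \<open>F'\<close> and
    \<open>G\<close> to that of \<open>p\<close>, \<open>q\<close>, \<open>V\<close> and
    \<open>V'\<close>.\<close>
  have F'_eq: "F' y h = (\<Sum>i\<in>UNIV. V y $ i * (\<Sum>j\<in>UNIV. h $ j * q i j y) + V' y h $ i * p i y)"
    if "y \<noteq> fst x0" for y h
    unfolding F'_def q_def by (simp only: expand[OF p[OF that], where h = h])
  have cF': "continuous_on (- {fst x0}) (\<lambda>y. F' y h)" for h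
  proof -
    have "continuous_on (- {fst x0}) (\<lambda>y. \<Sum>i\<in>UNIV. V y $ i * (\<Sum>j\<in>UNIV. h $ j * q i j y) + V' y h $ i * p i y)"
      by (intro continuous_intros continuous_on_geometry continuous_on_V' q cp)
    then show ?thesis by (rule continuous_on_eq) (simp add: F'_eq)
  qed
  have cG: "continuous_on (- {fst x0}) G"
  proof -
    have "continuous_on (- {fst x0}) (\<lambda>y. V' y (V y))"
      unfolding V'_def ch'_def using sh_pos
      by (intro continuous_intros continuous_on_geometry) force+
    then have "continuous_on (- {fst x0}) (\<lambda>y. \<Sum>i\<in>UNIV. V y $ i * (\<Sum>j\<in>UNIV. V y $ j * q i j y) + V' y (V y) $ i * p i y)"
      by (intro continuous_intros continuous_on_geometry q cp)
    then show ?thesis by (rule continuous_on_eq) (simp add: F'_eq G_def)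
  qed
  have w0: "w y = 0" if "y \<noteq> fst x0" "y \<notin> K" for y
  proof -
    have "hyp_chart y \<notin> K0" using that(2) by (force simp: K_def hyp_chart_def)
    then show ?thesis
      using K0(3)[of "hyp_chart y"] that(1) by (simp add: w_def hyp_chart_in chart_eq_pole)
  qed
  have O: "open (- {fst x0} - K)" using K by (intro open_Diff UO compact_imp_closed)
  have F0: "F y = 0" if "y \<notin> K" for y
  proof (cases "y = fst x0")
    \<comment> \<open>Integration by parts asks for \<open>F y = 0\<close> at the pole too; there
      \<open>sh y = 0\<close>, and division by zero makes \<open>V y\<close> zero.\<close>
    case True
    then show ?thesis using pole_chart pole
      by (simp add: F_def V_def sh_def ch_def hyperbolic_space_def)
  next
    case False
    have "(w has_derivative (\<lambda>h. 0)) (at y)"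
      by (rule has_derivative_transform_within_open[of "\<lambda>_. 0", OF _ O]) (use that False w0 in auto)
    then have "frechet_derivative w (at y) = (\<lambda>h. 0)" by (rule frechet_derivative_at[symmetric])
    then show ?thesis by (simp add: F_def p_def)
  qed
  have cF: "continuous_on (- {fst x0}) F"
    using F by (auto intro!: continuous_at_imp_continuous_on has_derivative_continuous)
  have rd: "radial_deriv x0 u (hyp_chart y) = F y" if "y \<noteq> fst x0" for y
  proof -
    have "radial_deriv x0 u (hyp_chart y) = frechet_derivative w (at y) (V y)"
      by (rule radial_deriv_chart[OF that w[OF that, THEN frechet_derivative_works[THEN iffD1]]])
        (simp add: w_def)
    then show ?thesis by (simp only: expand[OF w[OF that], where h = "V y"] F_def p_def)
  qed
  \<comment> \<open>The same chart formula once more, with \<open>F\<close> in place of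
    \<open>w\<close>; by \<open>rd\<close> it agrees with the first radial derivative off the
    pole.\<close>
  have rdd: "radial_deriv x0 (radial_deriv x0 u) (hyp_chart y) = G y" if "y \<noteq> fst x0" for y
    unfolding G_def by (rule radial_deriv_chart[OF that F[OF that] rd])
  have grad: "minkowski (radial_gradient x0 u (hyp_chart y)) (radial_gradient x0 u (hyp_chart y)) = (F y)\<^sup>2"
    if "y \<noteq> fst x0" for y
    using radial_gradient_sq[OF pole hyp_chart_in] chart_eq_pole that rd[OF that] by metis
  have lap: "radial_laplacian x0 u (hyp_chart y) = G y + (real CARD('n) - 1) * ct y * F y"
    if "y \<noteq> fst x0" for y
    unfolding radial_laplacian_def rd[OF that] rdd[OF that] rad_def[symmetric] cosh_rad sinh_rad[OF that] ct_def ..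
  have G0: "G y = 0" if "y \<notin> K" "y \<noteq> fst x0" for y
  proof -
    have "(F has_derivative (\<lambda>h. 0)) (at y)"
      by (rule has_derivative_transform_within_open[of "\<lambda>_. 0", OF _ O]) (use that F0 in auto)
    then have "F' y = (\<lambda>h. 0)" using F[OF that(2)] by (rule has_derivative_unique[symmetric])
    then show ?thesis by (simp add: G_def)
  qed
  have 1: "(LINT x|hyp_volume. (radial_laplacian x0 u x)\<^sup>2
          - lam * minkowski (radial_gradient x0 u x) (radial_gradient x0 u x))
      = (LINT y:K|lborel. rho y * ((G y + (real CARD('n) - 1) * ct y * F y)\<^sup>2 - lam * (F y)\<^sup>2))"
    by (intro integral_hyp_volume K aK continuous_intros cF cG continuous_on_geometry)
      (simp_all add: grad lap F0 G0)
  have 2: "(LINT x|hyp_volume. (hyp_dist x0 x)\<^sup>2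
          * minkowski (radial_gradient x0 u x) (radial_gradient x0 u x))
      = (LINT y:K|lborel. rho y * ((rad y)\<^sup>2 * (F y)\<^sup>2))"
    by (intro integral_hyp_volume K aK continuous_intros cF continuous_on_geometry)
      (simp_all add: grad F0 rad_def)
  have 3: "(LINT x|hyp_volume. minkowski (radial_gradient x0 u x) (radial_gradient x0 u x))
      = (LINT y:K|lborel. rho y * (F y)\<^sup>2)"
    by (intro integral_hyp_volume K aK continuous_intros cF) (simp_all add: grad F0)
  show ?thesis
    unfolding 1 2 3 by (rule radial_uncertainty_chart[OF K aK F cF' G_def cG F0 lam])
qed

end

theorem theorem2p4:
  fixes x0 :: "(real^'n) \<times> real"
  assumes "CARD('n) \<ge> 2"
    and "x0 \<in> hyperbolic_space"
  shows "(\<forall>lam u. 0 \<le> lam \<and> lam \<le> ((real CARD('n) - 1) / 2)\<^sup>2 \<and> u \<in> test_functions x0 \<longrightarrow>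
      (LINT x|hyp_volume. (radial_laplacian x0 u x)\<^sup>2
          - lam * minkowski (radial_gradient x0 u x) (radial_gradient x0 u x))
      * (LINT x|hyp_volume. (hyp_dist x0 x)\<^sup>2
          * minkowski (radial_gradient x0 u x) (radial_gradient x0 u x))
      \<ge> (h_const CARD('n) lam)\<^sup>2
        * (LINT x|hyp_volume. minkowski (radial_gradient x0 u x) (radial_gradient x0 u x))\<^sup>2)
    \<and> (\<forall>u \<in> test_functions x0.
      (LINT x|hyp_volume. (radial_laplacian x0 u x)\<^sup>2)
      * (LINT x|hyp_volume. (hyp_dist x0 x)\<^sup>2
          * minkowski (radial_gradient x0 u x) (radial_gradient x0 u x))
      \<ge> (real CARD('n))\<^sup>2 / 4
        * (LINT x|hyp_volume. minkowski (radial_gradient x0 u x) (radial_gradient x0 u x))\<^sup>2)"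
proof -
  interpret hyp_pole x0 by unfold_locales (rule assms(2))
  \<comment> \<open>At \<open>lam = 0\<close> the root is
    \<open>sqrt ((N - 1)\<^sup>2) = N - 1\<close>, so the constant is \<open>N / 2\<close>.\<close>
  have h: "(h_const CARD('n) 0)\<^sup>2 = (real CARD('n))\<^sup>2 / 4"
    by (simp add: h_const_def power_divide)
  show ?thesis
    using radial_uncertainty radial_uncertainty[of _ 0, unfolded h] by simp
qed

end
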